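(* Let $(\vec\Gamma_n,v_n)$ be a sequence of rooted oriented graphs converging to $(\vec\Gamma,v)$, and $(\vec\Theta_m,y_m)$ a sequence converging to $(\vec\Theta,y)$, in the space of connected rooted oriented graphs. Denote by $(\vec\Delta,w)^0$ the connected component of $w$ in $\vec\Delta$, rooted at $w$. Then: for each fixed $m$, $(\vec\Gamma_n\otimes\vec\Theta_m,(v_n,y_m))^0\to(\vec\Gamma\otimes\vec\Theta_m,(v,y_m))^0$ as $n\to\infty$; for each fixed $n$, $(\vec\Gamma_n\otimes\vec\Theta_m,(v_n,y_m))^0\to(\vec\Gamma_n\otimes\vec\Theta,(v_n,y))^0$ as $m\to\infty$; $(\vec\Gamma\otimes\vec\Theta_m,(v,y_m))^0\to(\vec\Gamma\otimes\vec\Theta,(v,y))^0$ as $m\to\infty$; $(\vec\Gamma_n\otimes\vec\Theta,(v_n,y))^0\to(\vec\Gamma\otimes\vec\Theta,(v,y))^0$ as $n\to\infty$; and $(\vec\Gamma_n\otimes\vec\Theta_m,(v_n,y_m))^0\to(\vec\Gamma\otimes\vec\Theta,(v,y))^0$ as $n,m\to\infty$ simultaneously.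
   Context: Oriented graphs have vertices, edges and maps $\iota,\tau$; loops and multiple edges allowed; connectedness is in the non-oriented sense. The tensor product $\vec\Gamma\otimes\vec\Delta$ has vertex set $V(\vec\Gamma)\times V(\vec\Delta)$ and an edge $(e,f)$ from $(v_1,w_1)$ to $(v_2,w_2)$ for each edge $e\colon v_1\to v_2$ of $\vec\Gamma$ and $f\colon w_1\to w_2$ of $\vec\Delta$. The space of connected rooted oriented graphs (up to rooted isomorphism) carries the distance $d((\vec\Gamma,v),(\vec\Delta,w))=1/(1+r)$, where $r$ is the largest integer such that the balls of radius $r$ around $v$ and $w$ (balls taken in the underlying non-oriented graph, keeping the orientation of edges) are isomorphic as rooted oriented graphs. *)

theory Defs
  imports
    Complex_Main
    "Graph_Theory.Digraph_Component"
    "Graph_Theory.Digraph_Isomorphism"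
begin

text \<open>Oriented graphs are the multi-digraphs of \<^locale>\<open>wf_digraph\<close>: loops and parallel arcs are
  allowed, and neither finiteness nor local finiteness is assumed.  The maps \<open>\<iota>\<close> and \<open>\<tau>\<close>
  are \<^const>\<open>tail\<close> and \<^const>\<open>head\<close>.\<close>

type_synonym ('a, 'b) rooted_digraph = "('a, 'b) pre_digraph \<times> 'a"

text \<open>\<^const>\<open>connected\<close> is connectedness of the underlying symmetric graph.\<close>

definition connected_rooted :: "('a, 'b) rooted_digraph \<Rightarrow> bool" where
  "connected_rooted = (\<lambda>(G, v). wf_digraph G \<and> connected G \<and> v \<in> verts G)"

definition tensor_product ::
    "('a, 'b) pre_digraph \<Rightarrow> ('c, 'd) pre_digraph \<Rightarrow> ('a \<times> 'c, 'b \<times> 'd) pre_digraph"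
    (infixr \<open>\<otimes>\<close> 70) where
  "G \<otimes> H = \<lparr>verts = verts G \<times> verts H, arcs = arcs G \<times> arcs H,
     tail = (\<lambda>(e, f). (tail G e, tail H f)), head = (\<lambda>(e, f). (head G e, head H f))\<rparr>"

definition root_component :: "('a, 'b) rooted_digraph \<Rightarrow> ('a, 'b) rooted_digraph" where
  "root_component = (\<lambda>(G, v). (G \<restriction> {u. v \<rightarrow>\<^sup>*\<^bsub>mk_symmetric G\<^esub> u}, v))"

text \<open>Distances are measured by walks that ignore orientation, but the ball is an induced subgraph
  of the oriented graph: it keeps every arc between two of its vertices, with its orientation.\<close>

definition rooted_ball :: "nat \<Rightarrow> ('a, 'b) rooted_digraph \<Rightarrow> ('a, 'b) rooted_digraph" where
  "rooted_ball r = (\<lambda>(G, v).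
     (G \<restriction> {u. \<exists>p. pre_digraph.awalk (mk_symmetric G) v p u \<and> length p \<le> r}, v))"

definition rooted_iso :: "('a, 'b) rooted_digraph \<Rightarrow> ('c, 'd) rooted_digraph \<Rightarrow> bool" where
  "rooted_iso = (\<lambda>(G, v) (H, w).
     \<exists>f. pre_digraph.digraph_isomorphism G f \<and> H = app_iso f G \<and> iso_verts f v = w)"

text \<open>The distance is \<open>1 / (1 + r)\<close> for the largest \<open>r\<close> such that the balls of radius \<open>r\<close> are
  isomorphic, with the usual conventions when there is no such \<open>r\<close>: it is \<open>0\<close> if the balls of
  every radius are isomorphic, and it has its largest value \<open>1\<close> if not even the balls of radius
  \<open>0\<close> are isomorphic, which happens if the roots carry different numbers of loops.

  The two graphs may have different vertex and arc types, because points of the space are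
  isomorphism classes.\<close>

definition rooted_dist :: "('a, 'b) rooted_digraph \<Rightarrow> ('c, 'd) rooted_digraph \<Rightarrow> real" where
  "rooted_dist X Y =
     (let R = {r. rooted_iso (rooted_ball r X) (rooted_ball r Y)}
      in if R = UNIV then 0 else if R = {} then 1 else 1 / (1 + real (Max R)))"

text \<open>Convergence in the space of connected rooted oriented graphs; this includes that all the
  terms and the limit are points of that space.\<close>

definition rooted_tendsto ::
    "('i \<Rightarrow> ('a, 'b) rooted_digraph) \<Rightarrow> ('c, 'd) rooted_digraph \<Rightarrow> 'i filter \<Rightarrow> bool" where
  "rooted_tendsto X Y F \<longleftrightarrow>
     (\<forall>i. connected_rooted (X i)) \<and> connected_rooted Y \<and>
     ((\<lambda>i. rooted_dist (X i) Y) \<longlongrightarrow> 0) F"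

end

theory Submission
  imports Defs
begin

text \<open>A walk in \<open>G \<otimes> H\<close> projects to walks of the same length in both factors, so the ball of
  radius \<open>r\<close> around \<open>(v, w)\<close> in \<open>G \<otimes> H\<close> lies in the product of the balls of radius \<open>r\<close> around \<open>v\<close>
  and \<open>w\<close>, and is already the ball of radius \<open>r\<close> in the tensor product of these two balls.  Hence it
  is determined, up to isomorphism, by the two balls.  It is also the ball in the component
  of \<open>(v, w)\<close>, and convergence to a limit means that the balls of each fixed radius are eventually
  isomorphic to that of the limit.\<close>

section \<open>Rooted isomorphisms and tensor products\<close>

text \<open>Trades the isomorphism record for a pair of bijections, which can be multiplied,
  inverted and restricted directly.\<close>

lemma rooted_iso_iff:
  "rooted_iso (G, v) (H, w) \<longleftrightarrow> wf_digraph G \<and>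
     (\<exists>\<phi> \<psi>. bij_betw \<phi> (verts G) (verts H) \<and> bij_betw \<psi> (arcs G) (arcs H) \<and>
       (\<forall>a\<in>arcs G. tail H (\<psi> a) = \<phi> (tail G a) \<and> head H (\<psi> a) = \<phi> (head G a)) \<and> \<phi> v = w)"
  (is "?L \<longleftrightarrow> ?R")
proof
  assume ?L
  then obtain f where "pre_digraph.digraph_isomorphism G f" "H = app_iso f G" "iso_verts f v = w"
    unfolding rooted_iso_def prod.case by blast
  then show ?R
    by (intro conjI exI[of _ "iso_verts f"] exI[of _ "iso_arcs f"])
      (simp_all add: pre_digraph.digraph_isomorphism_def bij_betw_def)
next
  assume ?R
  then obtain \<phi> \<psi> where *: "wf_digraph G"
    "bij_betw \<phi> (verts G) (verts H)" "bij_betw \<psi> (arcs G) (arcs H)"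
    "\<forall>a\<in>arcs G. tail H (\<psi> a) = \<phi> (tail G a) \<and> head H (\<psi> a) = \<phi> (head G a)" "\<phi> v = w"
    by blast
  \<comment> \<open>With the end maps of \<open>H\<close> itself as fields,
    \<open>H = app_iso f G\<close> holds as an equality of records, also for their values outside
    \<open>arcs H\<close>.\<close>
  define f where
    "f = \<lparr>iso_verts = \<phi>, iso_arcs = \<psi>, iso_head = head H, iso_tail = tail H\<rparr>"
  have "pre_digraph.digraph_isomorphism G f"
    using * by (simp add: pre_digraph.digraph_isomorphism_def f_def bij_betw_def)
  moreover have "H = app_iso f G"
    using *(2-4) by (intro pre_digraph.equality) (simp_all add: f_def bij_betw_def)
  moreover have "iso_verts f v = w"
    using *(5) by (simp add: f_def)
  ultimately show ?L
    unfolding rooted_iso_def prod.case by blast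
qed

lemma rooted_iso_refl: "wf_digraph G \<Longrightarrow> rooted_iso (G, v) (G, v)"
  unfolding rooted_iso_iff by (intro conjI exI[of _ id]) simp_all

lemma wf_tensor_product: "wf_digraph G \<Longrightarrow> wf_digraph H \<Longrightarrow> wf_digraph (G \<otimes> H)"
  by (auto simp: wf_digraph_def tensor_product_def)

lemma verts_tensor_product: "verts (G \<otimes> H) = verts G \<times> verts H"
  by (simp add: tensor_product_def)

lemma rooted_iso_tensor_product:
  assumes "rooted_iso (G, v) (G', v')" and "rooted_iso (H, w) (H', w')"
  shows "rooted_iso (G \<otimes> H, (v, w)) (G' \<otimes> H', (v', w'))"
proof -
  obtain \<phi> \<psi> where 1: "wf_digraph G"
    "bij_betw \<phi> (verts G) (verts G')" "bij_betw \<psi> (arcs G) (arcs G')"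
    "\<forall>a\<in>arcs G. tail G' (\<psi> a) = \<phi> (tail G a) \<and> head G' (\<psi> a) = \<phi> (head G a)" "\<phi> v = v'"
    using assms(1) unfolding rooted_iso_iff by blast
  obtain \<phi>' \<psi>' where 2: "wf_digraph H"
    "bij_betw \<phi>' (verts H) (verts H')" "bij_betw \<psi>' (arcs H) (arcs H')"
    "\<forall>a\<in>arcs H. tail H' (\<psi>' a) = \<phi>' (tail H a) \<and> head H' (\<psi>' a) = \<phi>' (head H a)" "\<phi>' w = w'"
    using assms(2) unfolding rooted_iso_iff by blast
  have "wf_digraph (G \<otimes> H)"
    using 1(1) 2(1) by (rule wf_tensor_product)
  then show ?thesis
    unfolding rooted_iso_iff using 1 2
    by (intro conjI exI[of _ "map_prod \<phi> \<phi>'"] exI[of _ "map_prod \<psi> \<psi>'"])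
      (auto simp: tensor_product_def intro!: bij_betw_map_prod)
qed

section \<open>Induced subgraphs and balls\<close>

lemma wf_induce_subgraph: "wf_digraph G \<Longrightarrow> wf_digraph (G \<restriction> U)"
  by (rule wf_digraph.wellformed_induce_subgraph)

text \<open>An arc \<open>(e, f)\<close> has both ends in \<open>U \<times> W\<close> iff
  \<open>e\<close> has its ends in \<open>U\<close> and \<open>f\<close> has its ends in
  \<open>W\<close>. This makes the product of two balls an induced subgraph of the product.\<close>

lemma tensor_product_induce_subgraph:
  "(G \<restriction> U) \<otimes> (H \<restriction> W) = (G \<otimes> H) \<restriction> (U \<times> W)"
  by (auto simp: tensor_product_def induce_subgraph_def)

lemma induce_subgraph_twice: "U \<subseteq> C \<Longrightarrow> (G \<restriction> C) \<restriction> U = G \<restriction> U"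
  by (auto simp: induce_subgraph_def)

text \<open>Growing balls one layer of neighbours at a time lets inclusions between them be proved
  by induction on the radius, without handling walks.\<close>

primrec ball_verts :: "('a, 'b) pre_digraph \<Rightarrow> 'a \<Rightarrow> nat \<Rightarrow> 'a set" where
  "ball_verts G v 0 = {v}"
| "ball_verts G v (Suc r) =
     ball_verts G v r \<union> parcs (mk_symmetric G) `` ball_verts G v r"

lemma ball_verts_eq_awalk:
  assumes "wf_digraph G" and "v \<in> verts G"
  shows "ball_verts G v r =
    {u. \<exists>p. pre_digraph.awalk (mk_symmetric G) v p u \<and> length p \<le> r}"
proof (induction r)
  case 0
  then show ?case
    using assms by (auto simp: pre_digraph.awalk_def pre_digraph.cas.simps)
next
  case (Suc r)
  interpret S: pair_wf_digraph "mk_symmetric G"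
    using assms(1) by (rule wf_digraph.wellformed_mk_symmetric)
  have "u \<in> ball_verts G v (Suc r)" if p: "S.awalk v p u" "length p \<le> Suc r" for u p
  \<comment> \<open>The walk is cut at its last arc, because the recursion enlarges the ball at its
    outer end.\<close>
  proof (cases p rule: rev_cases)
    case Nil
    then show ?thesis using p by (auto simp: Suc.IH)
  next
    case (snoc q e)
    then have "S.awalk v q (fst e)" "e \<in> parcs (mk_symmetric G)" "snd e = u" "length q \<le> r"
      using p by (auto simp: S.awalk_Cons_iff S.awalk_Nil_iff)
    then show ?thesis by (cases e) (auto simp: Suc.IH)
  qed
  moreover have "\<exists>p. S.awalk v p u \<and> length p \<le> Suc r"
    if "S.awalk v p x" "length p \<le> r" "(x, u) \<in> parcs (mk_symmetric G)" for p x u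
  proof -
    have "S.awalk x [(x, u)] u"
      using S.arc_implies_awalk[of "(x, u)"] that by simp
    then have "S.awalk v (p @ [(x, u)]) u"
      using that(1) by (rule S.awalk_appendI[rotated])
    then show ?thesis
      using that by (intro exI[of _ "p @ [(x, u)]"]) simp
  qed
  ultimately show ?case
    by (auto simp: Suc.IH intro: le_SucI)
qed

lemma rooted_ball_eq:
  assumes "wf_digraph G" and "v \<in> verts G"
  shows "rooted_ball r (G, v) = (G \<restriction> ball_verts G v r, v)"
  by (simp add: rooted_ball_def ball_verts_eq_awalk[OF assms])

text \<open>Every walk is finite, and its length is a radius that suffices.\<close>

lemma root_component_eq:
  assumes "wf_digraph G" and "v \<in> verts G"
  shows "root_component (G, v) = (G \<restriction> (\<Union>r. ball_verts G v r), v)"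
proof -
  interpret S: pair_wf_digraph "mk_symmetric G"
    using assms(1) by (rule wf_digraph.wellformed_mk_symmetric)
  have "{u. v \<rightarrow>\<^sup>*\<^bsub>mk_symmetric G\<^esub> u} = (\<Union>r. ball_verts G v r)"
    by (auto simp: S.reachable_awalk ball_verts_eq_awalk[OF assms])
  then show ?thesis
    by (simp add: root_component_def)
qed

lemma root_in_ball_verts: "v \<in> ball_verts G v r"
  by (induction r) auto

lemma ball_verts_mono: "r \<le> s \<Longrightarrow> ball_verts G v r \<subseteq> ball_verts G v s"
  by (rule lift_Suc_mono_le[of "ball_verts G v"]) auto

text \<open>Only the arcs inside \<open>U\<close> are needed, since every ball of radius \<open>s \<le> r\<close> is built from
  arcs of the ball of radius \<open>r\<close>.\<close>

lemma ball_verts_hom: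
  assumes U: "ball_verts G v r \<subseteq> U"
    and hom: "\<And>a. a \<in> arcs G \<Longrightarrow> tail G a \<in> U \<Longrightarrow> head G a \<in> U \<Longrightarrow>
      \<psi> a \<in> arcs H \<and> tail H (\<psi> a) = \<phi> (tail G a) \<and> head H (\<psi> a) = \<phi> (head G a)"
    and "\<phi> v = w" and "s \<le> r"
  shows "\<phi> ` ball_verts G v s \<subseteq> ball_verts H w s"
  using \<open>s \<le> r\<close>
proof (induction s)
  case 0
  then show ?case using \<open>\<phi> v = w\<close> by simp
next
  case (Suc s)
  have IH: "\<phi> ` ball_verts G v s \<subseteq> ball_verts H w s"
    using Suc by simp
  have sub: "ball_verts G v (Suc s) \<subseteq> U"
    using ball_verts_mono[OF Suc.prems] U by (rule subset_trans)
  have "\<phi> u \<in> ball_verts H w (Suc s)"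
    if xu: "x \<in> ball_verts G v s" "(x, u) \<in> parcs (mk_symmetric G)" for x u
  proof -
    have "x \<in> U" "u \<in> U"
      using sub xu by auto
    \<comment> \<open>The adjacency comes from an arc of \<open>G\<close> between \<open>x\<close>
      and \<open>u\<close>, in one direction or the other; its image under \<open>\<psi>\<close>
      joins the images in the same direction.\<close>
    then have "(\<phi> x, \<phi> u) \<in> parcs (mk_symmetric H)"
      using xu(2) hom unfolding parcs_mk_symmetric by (auto intro!: bexI[of _ "\<psi> _"])
    then show ?thesis using IH xu(1) by auto
  qed
  then show ?case using IH by auto
qed

text \<open>The isomorphism and its inverse are homomorphisms on \<open>U\<close> and
  \<open>W\<close>, so by \<open>ball_verts_hom\<close> each maps ball into ball, and the
  isomorphism restricts to the balls. It is applied with larger balls and with products of balls as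
  \<open>U\<close> and \<open>W\<close>.\<close>

lemma rooted_iso_ball_if_rooted_iso_induced:
  assumes G: "wf_digraph G" "v \<in> verts G" and H: "wf_digraph H" "w \<in> verts H"
    and iso: "rooted_iso (G \<restriction> U, v) (H \<restriction> W, w)"
    and U: "ball_verts G v r \<subseteq> U" and W: "ball_verts H w r \<subseteq> W"
  shows "rooted_iso (rooted_ball r (G, v)) (rooted_ball r (H, w))"
proof -
  let ?AG = "\<lambda>U. {a \<in> arcs G. tail G a \<in> U \<and> head G a \<in> U}"
  let ?AH = "\<lambda>U. {a \<in> arcs H. tail H a \<in> U \<and> head H a \<in> U}"
  let ?B = "ball_verts G v r" and ?B' = "ball_verts H w r"
  obtain \<phi> \<psi> where \<phi>: "bij_betw \<phi> U W"
    and \<psi>: "bij_betw \<psi> (?AG U) (?AH W)"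
    and ends: "\<And>a. a \<in> ?AG U \<Longrightarrow> tail H (\<psi> a) = \<phi> (tail G a) \<and> head H (\<psi> a) = \<phi> (head G a)"
    and root: "\<phi> v = w"
    using iso unfolding rooted_iso_iff by auto
  have vU: "v \<in> U"
    using U root_in_ball_verts by fast
  define \<phi>' \<psi>' where "\<phi>' = the_inv_into U \<phi>" and "\<psi>' = the_inv_into (?AG U) \<psi>"
  have \<phi>': "\<phi>' (\<phi> x) = x" if "x \<in> U" for x
    using \<phi> that by (simp add: \<phi>'_def bij_betw_def the_inv_into_f_f)
  have \<phi>'': "\<phi> (\<phi>' x) = x" if "x \<in> W" for x
    using \<phi> that by (simp add: \<phi>'_def bij_betw_def f_the_inv_into_f)
  have \<psi>': "\<psi>' a \<in> ?AG U \<and> \<psi> (\<psi>' a) = a" if "a \<in> ?AH W" for a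
    using \<psi> that the_inv_into_into[of \<psi> "?AG U" a "?AG U"]
    by (simp add: \<psi>'_def bij_betw_def f_the_inv_into_f)
  \<comment> \<open>Apply \<open>ends\<close> to the arc \<open>\<psi>' a\<close> and cancel
    \<open>\<phi>\<close> by \<open>\<phi>'\<close>.\<close>
  have ends': "tail G (\<psi>' a) = \<phi>' (tail H a) \<and> head G (\<psi>' a) = \<phi>' (head H a)"
    if "a \<in> ?AH W" for a
    using \<psi>'[OF that] ends[of "\<psi>' a"] \<phi>'[of "tail G (\<psi>' a)"] \<phi>'[of "head G (\<psi>' a)"] by auto
  have sub: "\<phi> ` ?B \<subseteq> ?B'"
    using U by (rule ball_verts_hom[where \<psi> = \<psi>])
      (use bij_betwE[OF \<psi>] ends root in auto)
  have sub': "\<phi>' ` ?B' \<subseteq> ?B"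
    using W by (rule ball_verts_hom[where \<psi> = \<psi>'])
      (use \<psi>' ends' \<phi>'[OF vU] root in auto)
  have "?B' \<subseteq> \<phi> ` ?B"
  proof
    fix x assume "x \<in> ?B'"
    then have "\<phi>' x \<in> ?B" "\<phi> (\<phi>' x) = x" using sub' \<phi>'' W by auto
    then show "x \<in> \<phi> ` ?B" by (metis imageI)
  qed
  then have verts: "bij_betw \<phi> ?B ?B'"
    using sub U \<phi> unfolding bij_betw_def by (blast intro: inj_on_subset)
  \<comment> \<open>The balls are induced, so an arc belongs to one as soon as its ends do; the arc
    bijection therefore restricts along with the vertex bijection.\<close>
  have "\<psi> ` ?AG ?B = ?AH ?B'"
  proof
    show "\<psi> ` ?AG ?B \<subseteq> ?AH ?B'"
    proof (rule image_subsetI)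
      fix a assume a: "a \<in> ?AG ?B"
      then have aU: "a \<in> ?AG U" using U by blast
      then have "\<psi> a \<in> ?AH W" using \<psi> by (rule bij_betw_apply[rotated])
      then show "\<psi> a \<in> ?AH ?B'"
        using ends[OF aU] a sub by auto
    qed
    show "?AH ?B' \<subseteq> \<psi> ` ?AG ?B"
    proof
      fix a assume a: "a \<in> ?AH ?B'"
      then have aW: "a \<in> ?AH W" using W by blast
      have "\<psi>' a \<in> ?AG ?B"
        using \<psi>'[OF aW] ends'[OF aW] a sub' by auto
      then show "a \<in> \<psi> ` ?AG ?B"
        by (rule rev_image_eqI) (use \<psi>'[OF aW] in simp)
    qed
  qed
  moreover have "?AG ?B \<subseteq> ?AG U"
    using U by blast
  ultimately have arcs: "bij_betw \<psi> (?AG ?B) (?AH ?B')"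
    using \<psi> unfolding bij_betw_def by (blast intro: inj_on_subset)
  have "tail H (\<psi> a) = \<phi> (tail G a) \<and> head H (\<psi> a) = \<phi> (head G a)" if "a \<in> ?AG ?B" for a
    using that U by (intro ends) blast
  then show ?thesis
    unfolding rooted_ball_eq[OF G] rooted_ball_eq[OF H] rooted_iso_iff
    using verts arcs root wf_induce_subgraph[OF G(1)]
    by (intro conjI exI[of _ \<phi>] exI[of _ \<psi>]) simp_all
qed

text \<open>The balls of radius \<open>r\<close> serve as \<open>U\<close> and \<open>W\<close>.
  Thus the radii with isomorphic balls form a downward closed set.\<close>

lemma rooted_iso_ball_le:
  assumes "wf_digraph G" "v \<in> verts G" "wf_digraph H" "w \<in> verts H"
    and "rooted_iso (rooted_ball r (G, v)) (rooted_ball r (H, w))" and "s \<le> r"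
  shows "rooted_iso (rooted_ball s (G, v)) (rooted_ball s (H, w))"
  using assms(5) ball_verts_mono[OF \<open>s \<le> r\<close>] ball_verts_mono[OF \<open>s \<le> r\<close>]
  unfolding rooted_ball_eq[OF assms(1,2), of r] rooted_ball_eq[OF assms(3,4), of r]
  by (rule rooted_iso_ball_if_rooted_iso_induced[OF assms(1-4)])

text \<open>Both projections are homomorphisms, hence do not increase distances. The inclusion can
  be strict.\<close>

lemma ball_verts_tensor_product:
  "ball_verts (G \<otimes> H) (v, w) r \<subseteq> ball_verts G v r \<times> ball_verts H w r"
proof -
  have "fst ` ball_verts (G \<otimes> H) (v, w) r \<subseteq> ball_verts G v r"
    by (rule ball_verts_hom[where \<psi> = fst and U = UNIV and r = r]) (auto simp: tensor_product_def)
  moreover have "snd ` ball_verts (G \<otimes> H) (v, w) r \<subseteq> ball_verts H w r"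
    by (rule ball_verts_hom[where \<psi> = snd and U = UNIV and r = r]) (auto simp: tensor_product_def)
  ultimately show ?thesis by (auto simp: image_subset_iff mem_Times_iff)
qed

lemma rooted_iso_ball_tensor_product:
  assumes G: "wf_digraph G" "v \<in> verts G" and G': "wf_digraph G'" "v' \<in> verts G'"
    and H: "wf_digraph H" "w \<in> verts H" and H': "wf_digraph H'" "w' \<in> verts H'"
    and "rooted_iso (rooted_ball r (G, v)) (rooted_ball r (G', v'))"
    and "rooted_iso (rooted_ball r (H, w)) (rooted_ball r (H', w'))"
  shows "rooted_iso (rooted_ball r (G \<otimes> H, (v, w))) (rooted_ball r (G' \<otimes> H', (v', w')))"
proof (rule rooted_iso_ball_if_rooted_iso_induced)
  show "rooted_iso ((G \<otimes> H) \<restriction> (ball_verts G v r \<times> ball_verts H w r), (v, w))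
      ((G' \<otimes> H') \<restriction> (ball_verts G' v' r \<times> ball_verts H' w' r), (v', w'))"
    using assms
    by (simp add: rooted_ball_eq rooted_iso_tensor_product flip: tensor_product_induce_subgraph)
qed (use assms in \<open>simp_all add: wf_tensor_product verts_tensor_product ball_verts_tensor_product\<close>)

section \<open>The component of the root\<close>

text \<open>The identity is a homomorphism from \<open>G \<restriction> C\<close> to
  \<open>G\<close>, and in the other direction on the arcs inside \<open>C\<close>.\<close>

lemma ball_verts_induce_subgraph:
  assumes "ball_verts G v r \<subseteq> C"
  shows "ball_verts (G \<restriction> C) v r = ball_verts G v r"
proof
  show "ball_verts (G \<restriction> C) v r \<subseteq> ball_verts G v r"
    using ball_verts_hom[of "G \<restriction> C" v r UNIV id G id v r] by auto
  show "ball_verts G v r \<subseteq> ball_verts (G \<restriction> C) v r"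
    using ball_verts_hom[of G v r C id "G \<restriction> C" id v r] assms by auto
qed

lemma connected_rooted_root_component:
  assumes G: "wf_digraph G" "v \<in> verts G"
  shows "connected_rooted (root_component (G, v))"
proof -
  define C where "C = (\<Union>r. ball_verts G v r)"
  have C: "ball_verts G v r \<subseteq> C" for r by (auto simp: C_def)
  have wf: "wf_digraph (G \<restriction> C)" by (rule wf_induce_subgraph[OF G(1)])
  have v: "v \<in> verts (G \<restriction> C)"
    using G(2) C[of 0] by auto
  interpret S: pair_wf_digraph "mk_symmetric (G \<restriction> C)"
    using wf by (rule wf_digraph.wellformed_mk_symmetric)
  \<comment> \<open>A vertex of \<open>C\<close> lies in some ball of \<open>G\<close>, which is
    also a ball of \<open>G \<restriction> C\<close>; so the root reaches it without leaving
    \<open>C\<close>.\<close>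
  have reach: "v \<rightarrow>\<^sup>*\<^bsub>mk_symmetric (G \<restriction> C)\<^esub> u" if "u \<in> verts (G \<restriction> C)" for u
  proof -
    have "u \<in> C" using that by simp
    then obtain r where "u \<in> ball_verts G v r" unfolding C_def by blast
    then have "u \<in> ball_verts (G \<restriction> C) v r"
      using ball_verts_induce_subgraph[OF C] by blast
    then show ?thesis
      unfolding ball_verts_eq_awalk[OF wf v] S.reachable_awalk by blast
  qed
  have "connected (G \<restriction> C)"
    unfolding connected_def
  proof
    show "verts (with_proj (mk_symmetric (G \<restriction> C))) \<noteq> {}" using v by auto
    fix u u' assume "u \<in> verts (with_proj (mk_symmetric (G \<restriction> C)))"
      "u' \<in> verts (with_proj (mk_symmetric (G \<restriction> C)))"
    \<comment> \<open>By symmetry \<open>u\<close> reaches the root, and the root reaches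
      \<open>u'\<close>.\<close>
    then show "u \<rightarrow>\<^sup>*\<^bsub>mk_symmetric (G \<restriction> C)\<^esub> u'"
      using reach[of u] reach[of u'] symmetric_reachable[OF symmetric_mk_symmetric]
      by (metis S.reachable_trans pverts_mk_symmetric with_proj_simps(1))
  qed
  then show ?thesis
    using wf v by (simp add: root_component_eq[OF G] connected_rooted_def flip: C_def)
qed

lemma rooted_ball_root_component:
  assumes G: "wf_digraph G" "v \<in> verts G"
  shows "rooted_ball r (root_component (G, v)) = rooted_ball r (G, v)"
proof -
  define C where "C = (\<Union>r. ball_verts G v r)"
  have C: "ball_verts G v r \<subseteq> C" by (auto simp: C_def)
  have "v \<in> verts (G \<restriction> C)"
    using G(2) C root_in_ball_verts by fastforce
  then show ?thesis
    using wf_induce_subgraph[OF G(1), of C]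
    by (simp add: root_component_eq[OF G] rooted_ball_eq G ball_verts_induce_subgraph[OF C]
        induce_subgraph_twice[OF C] flip: C_def)
qed

section \<open>Distance and convergence in terms of balls\<close>

text \<open>The strict inequality asks for a largest radius above \<open>r\<close>, hence the ball
  of radius \<open>Suc r\<close>.\<close>

lemma rooted_dist_less_iff:
  assumes "connected_rooted X" and "connected_rooted Y"
  shows "rooted_dist X Y < 1 / (1 + real r) \<longleftrightarrow>
    rooted_iso (rooted_ball (Suc r) X) (rooted_ball (Suc r) Y)"
proof -
  define R where "R = {r. rooted_iso (rooted_ball r X) (rooted_ball r Y)}"
  have down: "s \<in> R" if "r \<in> R" "s \<le> r" for r s
    using that assms rooted_iso_ball_le[of "fst X" "snd X" "fst Y" "snd Y" r s]
    by (auto simp: R_def connected_rooted_def split: prod.splits)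
  \<comment> \<open>A missing radius bounds \<open>R\<close>, by downward closure, so
    \<open>Max R\<close> is meaningful.\<close>
  have fin: "finite R" if R: "R \<noteq> UNIV"
  proof -
    obtain k where "k \<notin> R" using R by blast
    then have "R \<subseteq> {..<k}" using down by (metis lessThan_iff not_le subsetI)
    then show ?thesis by (rule finite_subset) simp
  qed
  have "rooted_dist X Y < 1 / (1 + real r) \<longleftrightarrow> Suc r \<in> R"
  \<comment> \<open>The conventional values fit: \<open>0\<close> is below every threshold, and
    \<open>1\<close> is below none.\<close>
  proof (cases "R = UNIV \<or> R = {}")
    case True
    then show ?thesis
      by (auto simp: rooted_dist_def divide_simps simp flip: R_def)
  next
    case False
    then have "Suc r \<in> R \<longleftrightarrow> r < Max R"
      using down[OF Max_in, of "Suc r"] fin by (auto simp: Suc_le_eq[symmetric])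
    then show ?thesis
      using False by (simp add: rooted_dist_def divide_simps flip: R_def)
  qed
  then show ?thesis by (simp add: R_def)
qed

lemma rooted_dist_nonneg: "0 \<le> rooted_dist X Y"
  by (auto simp: rooted_dist_def Let_def)

text \<open>The thresholds \<open>1 / (1 + real r)\<close> become arbitrarily small, so they suffice
  to test convergence.\<close>

lemma rooted_tendsto_iff:
  "rooted_tendsto X Y F \<longleftrightarrow> (\<forall>i. connected_rooted (X i)) \<and> connected_rooted Y \<and>
     (\<forall>r. \<forall>\<^sub>F i in F. rooted_iso (rooted_ball r (X i)) (rooted_ball r Y))"
proof (cases "(\<forall>i. connected_rooted (X i)) \<and> connected_rooted Y")
  case True
  then have conn: "connected_rooted (X i)" "connected_rooted Y" for i by auto
  let ?P = "\<lambda>r i. rooted_iso (rooted_ball r (X i)) (rooted_ball r Y)"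
  have "((\<lambda>i. rooted_dist (X i) Y) \<longlongrightarrow> 0) F \<longleftrightarrow>
      (\<forall>e>0. \<forall>\<^sub>F i in F. rooted_dist (X i) Y < e)"
    by (simp add: tendsto_iff rooted_dist_nonneg)
  also have "\<dots> \<longleftrightarrow> (\<forall>r. \<forall>\<^sub>F i in F. ?P r i)"
  proof (intro iffI allI impI)
    fix r assume "\<forall>e>0. \<forall>\<^sub>F i in F. rooted_dist (X i) Y < e"
    then have "\<forall>\<^sub>F i in F. rooted_dist (X i) Y < 1 / (1 + real r)" by simp
    \<comment> \<open>The threshold yields one radius more than required; the smaller ball
      follows.\<close>
    then have "\<forall>\<^sub>F i in F. ?P (Suc r) i"
      by (simp add: rooted_dist_less_iff conn)
    then show "\<forall>\<^sub>F i in F. ?P r i"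
    proof eventually_elim
      case (elim i)
      then show ?case
        using conn(1)[of i] conn(2)
          rooted_iso_ball_le[of "fst (X i)" "snd (X i)" "fst Y" "snd Y" "Suc r" r]
        by (auto simp: connected_rooted_def split: prod.splits)
    qed
  next
    fix e :: real assume ev: "\<forall>r. \<forall>\<^sub>F i in F. ?P r i" and "e > 0"
    then obtain r where "1 / (1 + real r) < e"
      using reals_Archimedean[of e] by (auto simp: inverse_eq_divide add_ac)
    moreover have "\<forall>\<^sub>F i in F. rooted_dist (X i) Y < 1 / (1 + real r)"
      using ev by (simp add: rooted_dist_less_iff conn)
    ultimately show "\<forall>\<^sub>F i in F. rooted_dist (X i) Y < e"
      by (auto elim: eventually_mono)
  qed
  finally show ?thesis using True by (simp add: rooted_tendsto_def)
qed (auto simp: rooted_tendsto_def)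

lemma rooted_tendsto_const: "connected_rooted X \<Longrightarrow> rooted_tendsto (\<lambda>_. X) X F"
  by (cases X)
    (auto simp: rooted_tendsto_iff connected_rooted_def rooted_ball_eq
      intro!: always_eventually rooted_iso_refl wf_induce_subgraph)

lemma rooted_tendsto_compose:
  "rooted_tendsto X Y F \<Longrightarrow> filterlim g F F' \<Longrightarrow> rooted_tendsto (\<lambda>i. X (g i)) Y F'"
  by (auto simp: rooted_tendsto_def intro: filterlim_compose)

text \<open>A common index and an arbitrary filter let this one statement cover all five limits of
  the theorem.\<close>

lemma rooted_tendsto_root_component_tensor_product:
  assumes "rooted_tendsto (\<lambda>i. (Gs i, vs i)) (G, v) F"
    and "rooted_tendsto (\<lambda>i. (Hs i, ws i)) (H, w) F"
  shows "rooted_tendsto (\<lambda>i. root_component (Gs i \<otimes> Hs i, (vs i, ws i)))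
    (root_component (G \<otimes> H, (v, w))) F"
proof -
  have Gs: "wf_digraph (Gs i)" "vs i \<in> verts (Gs i)" and G: "wf_digraph G" "v \<in> verts G"
    and Hs: "wf_digraph (Hs i)" "ws i \<in> verts (Hs i)" and H: "wf_digraph H" "w \<in> verts H" for i
    using assms by (auto simp: rooted_tendsto_def connected_rooted_def)
  have Ps: "wf_digraph (Gs i \<otimes> Hs i)" "(vs i, ws i) \<in> verts (Gs i \<otimes> Hs i)"
    and P: "wf_digraph (G \<otimes> H)" "(v, w) \<in> verts (G \<otimes> H)" for i
    using Gs Hs G H by (simp_all add: wf_tensor_product verts_tensor_product)
  have "\<forall>\<^sub>F i in F. rooted_iso (rooted_ball r (root_component (Gs i \<otimes> Hs i, (vs i, ws i))))
      (rooted_ball r (root_component (G \<otimes> H, (v, w))))" for r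
  proof -
    have "\<forall>\<^sub>F i in F. rooted_iso (rooted_ball r (Gs i, vs i)) (rooted_ball r (G, v))"
      "\<forall>\<^sub>F i in F. rooted_iso (rooted_ball r (Hs i, ws i)) (rooted_ball r (H, w))"
      using assms by (auto simp: rooted_tendsto_iff)
    then show ?thesis
      by eventually_elim
        (simp add: rooted_ball_root_component Ps P rooted_iso_ball_tensor_product Gs Hs G H)
  qed
  then show ?thesis
    by (simp add: rooted_tendsto_iff connected_rooted_root_component Ps P)
qed

theorem theorem3p5:
  fixes \<Gamma>s :: "nat \<Rightarrow> ('a, 'b) pre_digraph" and vs :: "nat \<Rightarrow> 'a"
    and \<Gamma> :: "('c, 'd) pre_digraph" and v :: 'c
    and \<Theta>s :: "nat \<Rightarrow> ('e, 'f) pre_digraph" and ys :: "nat \<Rightarrow> 'e"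
    and \<Theta> :: "('g, 'h) pre_digraph" and y :: 'g
  assumes "rooted_tendsto (\<lambda>n. (\<Gamma>s n, vs n)) (\<Gamma>, v) sequentially"
    and "rooted_tendsto (\<lambda>m. (\<Theta>s m, ys m)) (\<Theta>, y) sequentially"
  shows
    "(\<forall>m. rooted_tendsto (\<lambda>n. root_component (\<Gamma>s n \<otimes> \<Theta>s m, (vs n, ys m)))
            (root_component (\<Gamma> \<otimes> \<Theta>s m, (v, ys m))) sequentially) \<and>
     (\<forall>n. rooted_tendsto (\<lambda>m. root_component (\<Gamma>s n \<otimes> \<Theta>s m, (vs n, ys m)))
            (root_component (\<Gamma>s n \<otimes> \<Theta>, (vs n, y))) sequentially) \<and>
     rooted_tendsto (\<lambda>m. root_component (\<Gamma> \<otimes> \<Theta>s m, (v, ys m)))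
       (root_component (\<Gamma> \<otimes> \<Theta>, (v, y))) sequentially \<and>
     rooted_tendsto (\<lambda>n. root_component (\<Gamma>s n \<otimes> \<Theta>, (vs n, y)))
       (root_component (\<Gamma> \<otimes> \<Theta>, (v, y))) sequentially \<and>
     rooted_tendsto (\<lambda>(n, m). root_component (\<Gamma>s n \<otimes> \<Theta>s m, (vs n, ys m)))
       (root_component (\<Gamma> \<otimes> \<Theta>, (v, y))) (sequentially \<times>\<^sub>F sequentially)"
proof -
  have "connected_rooted (\<Gamma>s n, vs n)" "connected_rooted (\<Gamma>, v)"
    "connected_rooted (\<Theta>s n, ys n)" "connected_rooted (\<Theta>, y)" for n
    using assms by (auto simp: rooted_tendsto_def)
  \<comment> \<open>Constant families supply the factor that stays fixed in the one-variable
    limits.\<close>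
  then have const: "rooted_tendsto (\<lambda>_. (\<Gamma>s n, vs n)) (\<Gamma>s n, vs n) sequentially"
    "rooted_tendsto (\<lambda>_. (\<Gamma>, v)) (\<Gamma>, v) sequentially"
    "rooted_tendsto (\<lambda>_. (\<Theta>s n, ys n)) (\<Theta>s n, ys n) sequentially"
    "rooted_tendsto (\<lambda>_. (\<Theta>, y)) (\<Theta>, y) sequentially" for n
    by (auto intro: rooted_tendsto_const)
  \<comment> \<open>For the simultaneous limit both sequences are reindexed by pairs, along the
    projections of the product filter.\<close>
  have "rooted_tendsto (\<lambda>p. (\<Gamma>s (fst p), vs (fst p))) (\<Gamma>, v) (sequentially \<times>\<^sub>F sequentially)"
    using assms(1) filtermap_fst_prod_filter
    by (rule rooted_tendsto_compose[unfolded filterlim_def])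
  moreover have
    "rooted_tendsto (\<lambda>p. (\<Theta>s (snd p), ys (snd p))) (\<Theta>, y) (sequentially \<times>\<^sub>F sequentially)"
    using assms(2) filtermap_snd_prod_filter
    by (rule rooted_tendsto_compose[unfolded filterlim_def])
  ultimately show ?thesis
    using assms const unfolding case_prod_beta
    by (intro conjI allI rooted_tendsto_root_component_tensor_product)
qed

end
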